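(* For every integer $j$, \[ \sum_{\mu\in \mathcal{P}_j}t^{h_{2,0}(\mu)}q^{|\mu|}= \frac{q^{\binom{2j}{2}}}{\prod_{i\geq 1}(1-q^{2i})(1-tq^{2i})}. \]
   Context: The $2$-core of a partition is obtained by repeatedly removing dominoes (rim hooks of length $2$) whose removal leaves a Young diagram until none remain; it is well defined, a staircase of size $\binom{2j}{2}=j(2j-1)$ for a unique integer $j$. $\mathcal{P}_j$ is the set of all partitions whose $2$-core has size $\binom{2j}{2}$. For a cell $v$, $a_v$ is its arm length (cells to its right) and $l_v$ its leg length (cells below it); $h_{2,0}(\mu)$ is the number of cells $v$ with $l_v=0$ and $2\mid a_v+1$. *)

theory Defs
  imports
    "HOL-Analysis.Infinite_Sum"
    "HOL-Analysis.Infinite_Products"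
    "HOL-Computational_Algebra.Formal_Power_Series"
    "HOL-Computational_Algebra.Polynomial"
    "HOL-Computational_Algebra.Fraction_Field"
begin

definition is_partition :: "nat list \<Rightarrow> bool" where
  "is_partition \<mu> \<longleftrightarrow> sorted_wrt (\<ge>) \<mu> \<and> 0 \<notin> set \<mu>"

text \<open>The cell \<open>(r, c)\<close> lies in row \<open>r\<close> and column \<open>c\<close>, both counted from 0; rows are
  numbered downwards and columns to the right (English convention).\<close>

definition cells :: "nat list \<Rightarrow> (nat \<times> nat) set" where
  "cells \<mu> = {(r, c). r < length \<mu> \<and> c < \<mu> ! r}"

definition arm :: "nat list \<Rightarrow> nat \<times> nat \<Rightarrow> nat" where
  "arm \<mu> v = card {w \<in> cells \<mu>. fst w = fst v \<and> snd w > snd v}"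

definition leg :: "nat list \<Rightarrow> nat \<times> nat \<Rightarrow> nat" where
  "leg \<mu> v = card {w \<in> cells \<mu>. snd w = snd v \<and> fst w > fst v}"

definition h20 :: "nat list \<Rightarrow> nat" where
  "h20 \<mu> = card {v \<in> cells \<mu>. leg \<mu> v = 0 \<and> 2 dvd arm \<mu> v + 1}"

definition is_domino :: "(nat \<times> nat) set \<Rightarrow> bool" where
  "is_domino D \<longleftrightarrow> (\<exists>r c. D = {(r, c), (r, Suc c)} \<or> D = {(r, c), (Suc r, c)})"

definition remove_domino :: "nat list \<Rightarrow> nat list \<Rightarrow> bool" where
  "remove_domino \<mu> \<nu> \<longleftrightarrow> is_partition \<mu> \<and> is_partition \<nu> \<and>
     cells \<nu> \<subseteq> cells \<mu> \<and> is_domino (cells \<mu> - cells \<nu>)"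

definition two_core :: "nat list \<Rightarrow> nat list" where
  "two_core \<mu> = (THE \<nu>. remove_domino\<^sup>*\<^sup>* \<mu> \<nu> \<and> \<not> (\<exists>\<rho>. remove_domino \<nu> \<rho>))"

text \<open>The binomial coefficient \<open>(2 * j) choose 2\<close> at an integer \<open>j\<close> of either sign; it is never negative.\<close>

definition core_size :: "int \<Rightarrow> nat" where
  "core_size j = nat (j * (2 * j - 1))"

lemma core_size_gbinomial: "real (core_size j) = real_of_int (2 * j) gchoose 2"
proof -
  have "j * (2 * j - 1) \<ge> 0"
    by (cases "j \<ge> 1") (auto simp: zero_le_mult_iff)
  then have "real (core_size j) = real_of_int (j * (2 * j - 1))"
    by (simp only: core_size_def of_nat_nat)
  also have "\<dots> = real_of_int (2 * j) gchoose 2"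
    by (simp add: gbinomial_prod_rev numeral_2_eq_2)
  finally show ?thesis .
qed

definition core_class :: "int \<Rightarrow> nat list set" where
  "core_class j = {\<mu>. is_partition \<mu> \<and> sum_list (two_core \<mu>) = core_size j}"

text \<open>The generating functions live in \<open>\<int>[t][[q]]\<close>.  Division of formal power series requires
  coefficients in a field, so \<open>\<int>[t]\<close> is embedded in its field of fractions.  Infinite sums and
  products refer to the \<open>q\<close>-adic topology, which is the library's metric on formal power series.\<close>

definition qX :: "int poly fract fps" where
  "qX = fps_X"

definition tX :: "int poly fract fps" where
  "tX = fps_const (Fract [:0, 1:] 1)"

end

(* Colour the cells like a checkerboard.  Removing a domino preserves the difference of the colour
   counts, and a staircase is determined by it, so fixing the 2-core means fixing this integer k.
   Deleting pairs of equal columns removes the factors 1 / (1 - t q^(2i)) and leaves the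
   partitions with distinct column lengths.  With at most n rows these have the generating function
   q^(k (2k - 1)) times the q^2-binomial coefficient of n over (n div 2 + k), by the q-Pascal rule
   (Berkovich and Garvan); it tends to the inverse of the product of all (1 - q^(2i)). *)
theory Submission
  imports Defs
begin

unbundle no vec_syntax
unbundle fps_syntax

section \<open>Partitions as antitone functions\<close>

text \<open>Padding with zeros turns partitions into total antitone functions, so that the row below
  the last one is available in gap formulas.\<close>

definition part :: "nat list \<Rightarrow> nat \<Rightarrow> nat" where
  "part \<mu> r = (if r < length \<mu> then \<mu> ! r else 0)"

lemma cells_part: "cells \<mu> = {(r, c). c < part \<mu> r}"
  by (auto simp: cells_def part_def split: if_splits)

lemma part_antimono:
  assumes "is_partition \<mu>" "r \<le> s"
  shows "part \<mu> s \<le> part \<mu> r"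
  using assms sorted_wrt_nth_less[of "(\<ge>)" \<mu> r s]
  by (cases "r = s") (auto simp: is_partition_def part_def)

lemma part_pos_iff: "is_partition \<mu> \<Longrightarrow> 0 < part \<mu> r \<longleftrightarrow> r < length \<mu>"
  by (auto simp: is_partition_def part_def) (metis gr0I nth_mem)

lemma part_inj:
  assumes "is_partition \<mu>" "is_partition \<nu>" "part \<mu> = part \<nu>"
  shows "\<mu> = \<nu>"
proof (rule nth_equalityI)
  have "r < length \<mu> \<longleftrightarrow> r < length \<nu>" for r
    using assms part_pos_iff by metis
  then show "length \<mu> = length \<nu>"
    by (metis linorder_neqE_nat less_irrefl)
  then show "\<mu> ! r = \<nu> ! r" if "r < length \<mu>" for r
    using that fun_cong[OF assms(3), of r] by (simp add: part_def)
qed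

text \<open>Converse to \<open>part\<close>: list the values before the first zero; antitonicity
  keeps all later ones zero.\<close>

lemma ex_partition:
  assumes anti: "\<And>r s. r \<le> s \<Longrightarrow> f s \<le> f r" and zero: "f n = 0"
  obtains \<nu> where "is_partition \<nu>" "part \<nu> = f"
proof -
  define m where "m = (LEAST m. f m = 0)"
  have m: "f m = 0" "\<And>r. r < m \<Longrightarrow> f r \<noteq> 0"
    unfolding m_def using LeastI[of "\<lambda>m. f m = 0", OF zero] not_less_Least by blast+
  let ?\<nu> = "map f [0..<m]"
  have "is_partition ?\<nu>"
    using anti by (auto simp: is_partition_def sorted_wrt_iff_nth_less dest: m(2))
  moreover have "f r = 0" if "m \<le> r" for r
    using anti[OF that] m(1) by simp
  then have "part ?\<nu> = f"
    by (auto simp: part_def fun_eq_iff not_less)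
  ultimately show ?thesis by (rule that)
qed

lemma cells_Sigma: "length \<mu> \<le> n \<Longrightarrow> cells \<mu> = Sigma {..<n} (\<lambda>r. {..<part \<mu> r})"
  by (auto simp: cells_part part_def split: if_splits)

lemma finite_cells: "finite (cells \<mu>)"
  by (simp add: cells_Sigma[OF order.refl])

lemma sum_list_part: "length \<mu> \<le> n \<Longrightarrow> sum_list \<mu> = (\<Sum>r<n. part \<mu> r)"
proof -
  assume "length \<mu> \<le> n"
  then have "(\<Sum>r<n. part \<mu> r) = (\<Sum>r<length \<mu>. part \<mu> r)"
    by (intro sum.mono_neutral_right) (auto simp: part_def)
  then show ?thesis
    by (simp add: sum_list_sum_nth part_def atLeast0LessThan)
qed

lemma card_cells: "card (cells \<mu>) = sum_list \<mu>"
  by (simp add: cells_Sigma[OF order.refl] sum_list_part[OF order.refl])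

lemma length_le_sum_list:
  assumes "is_partition \<mu>"
  shows "length \<mu> \<le> sum_list \<mu>"
proof -
  have "length \<mu> = (\<Sum>x\<leftarrow>\<mu>. 1)" by (induction \<mu>) auto
  also have "\<dots> \<le> (\<Sum>x\<leftarrow>\<mu>. x)"
    using assms by (intro sum_list_mono) (auto simp: is_partition_def Suc_le_eq intro: gr0I)
  finally show ?thesis by simp
qed

lemma finite_partitions: "finite {\<mu>. is_partition \<mu> \<and> sum_list \<mu> = N}"
proof (rule finite_subset)
  show "{\<mu>. is_partition \<mu> \<and> sum_list \<mu> = N} \<subseteq> {\<mu>. set \<mu> \<subseteq> {..N} \<and> length \<mu> \<le> N}"
    by (auto simp: member_le_sum_list length_le_sum_list)
qed (simp add: finite_lists_length_le)

section \<open>Arms, legs and \<open>h20\<close> in terms of row lengths\<close>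

lemma arm_part: "arm \<mu> (r, c) = part \<mu> r - Suc c"
proof -
  have "{w \<in> cells \<mu>. fst w = fst (r, c) \<and> snd w > snd (r, c)} = Pair r ` {Suc c..<part \<mu> r}"
    by (auto simp: cells_part)
  then show ?thesis
    by (simp add: arm_def card_image inj_on_def)
qed

lemma leg_eq_0_iff:
  assumes "is_partition \<mu>"
  shows "leg \<mu> (r, c) = 0 \<longleftrightarrow> part \<mu> (Suc r) \<le> c"
proof -
  let ?L = "{w \<in> cells \<mu>. snd w = snd (r, c) \<and> fst w > fst (r, c)}"
  have "leg \<mu> (r, c) = 0 \<longleftrightarrow> ?L = {}"
    using finite_cells[of \<mu>] by (simp add: leg_def)
  also have "\<dots> \<longleftrightarrow> part \<mu> (Suc r) \<le> c"
  proof
    assume "?L = {}"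
    then have "(Suc r, c) \<notin> ?L" by blast
    then show "part \<mu> (Suc r) \<le> c" by (simp add: cells_part)
  next
    assume *: "part \<mu> (Suc r) \<le> c"
    have "part \<mu> s \<le> c" if "r < s" for s
      using part_antimono[OF assms, of "Suc r" s] that * by simp
    then show "?L = {}" by (auto simp: cells_part not_less[symmetric])
  qed
  finally show ?thesis .
qed

text \<open>For a cell in column c of a row of length b, arm plus 1 is b - c. Over the overhang a
  \<le> c < b it runs through 1 to b - a, and half of these values, rounded down, are even.\<close>

lemma card_even_gaps:
  fixes a b :: nat
  shows "card {c. a \<le> c \<and> c < b \<and> even (b - c)} = (b - a) div 2"
proof -
  have "{c. a \<le> c \<and> c < b \<and> even (b - c)} = (\<lambda>i. b - 2 * Suc i) ` {..<(b - a) div 2}"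
  proof (intro equalityI subsetI)
    fix c assume "c \<in> {c. a \<le> c \<and> c < b \<and> even (b - c)}"
    then have "a \<le> c \<and> c < b \<and> even (b - c)" by (rule CollectD)
    then obtain k where c: "a \<le> c" "c < b" and k: "b - c = 2 * k" by (elim conjE evenE)
    then obtain i where "k = Suc i" by (cases k) auto
    then have "c = b - 2 * Suc i" "i < (b - a) div 2"
      using c k by auto
    then show "c \<in> (\<lambda>i. b - 2 * Suc i) ` {..<(b - a) div 2}" by blast
  qed auto
  moreover have "inj_on (\<lambda>i. b - 2 * Suc i) {..<(b - a) div 2}"
    by (rule inj_onI) simp
  ultimately show ?thesis by (simp only: card_image card_lessThan)
qed

text \<open>The gap between rows r and r + 1 is the multiplicity of r + 1 as a column length, so
  \<open>h20\<close> is the maximal number of disjoint pairs of equal columns.\<close>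

lemma h20_part:
  assumes "is_partition \<mu>" "length \<mu> \<le> n"
  shows "h20 \<mu> = (\<Sum>r<n. (part \<mu> r - part \<mu> (Suc r)) div 2)"
proof -
  have "{v \<in> cells \<mu>. leg \<mu> v = 0 \<and> 2 dvd arm \<mu> v + 1} =
        Sigma {..<n} (\<lambda>r. {c. part \<mu> (Suc r) \<le> c \<and> c < part \<mu> r \<and> even (part \<mu> r - c)})"
    unfolding cells_Sigma[OF assms(2)]
    by (auto simp: arm_part leg_eq_0_iff[OF assms(1)] simp flip: Suc_diff_Suc)
  also have "card \<dots> = (\<Sum>r<n. card {c. part \<mu> (Suc r) \<le> c \<and> c < part \<mu> r \<and> even (part \<mu> r - c)})"
    by (intro card_SigmaI) simp_all
  finally show ?thesis
    by (simp only: h20_def card_even_gaps)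
qed

section \<open>The 2-core and the checkerboard weight\<close>

text \<open>Known as the BG-rank: the difference of the two colour counts.\<close>

definition bg :: "nat list \<Rightarrow> int" where
  "bg \<mu> = (\<Sum>(r, c)\<in>cells \<mu>. (-1) ^ (r + c))"

lemma bg_part: "length \<mu> \<le> n \<Longrightarrow> bg \<mu> = (\<Sum>r<n. \<Sum>c<part \<mu> r. (-1) ^ (r + c))"
  by (simp add: bg_def cells_Sigma sum.Sigma)

text \<open>Adjacent cells carry opposite signs.\<close>

lemma remove_domino_bg:
  assumes "remove_domino \<mu> \<nu>"
  shows "bg \<nu> = bg \<mu>"
proof -
  let ?w = "\<lambda>(r, c). (-1 :: int) ^ (r + c)"
  have "sum ?w (cells \<mu> - cells \<nu>) = 0"
    using assms by (auto simp: remove_domino_def is_domino_def)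
  then show ?thesis
    using assms finite_cells[of \<mu>] sum_diff[of "cells \<mu>" "cells \<nu>" ?w]
    by (simp add: bg_def remove_domino_def)
qed

lemma remove_domino_sum_list:
  assumes "remove_domino \<mu> \<nu>"
  shows "sum_list \<nu> < sum_list \<mu>"
proof -
  have "cells \<nu> \<subset> cells \<mu>"
    using assms by (auto simp: remove_domino_def is_domino_def)
  then show ?thesis
    using finite_cells psubset_card_mono by (metis card_cells)
qed

text \<open>If rows \<open>r\<close> and \<open>r + 1\<close> differ by two, a horizontal domino can be removed from row \<open>r\<close>;
  below the last pair of equal rows the next row is shorter, so a vertical domino can be removed.\<close>

lemma irreducible_staircase:
  assumes \<nu>: "is_partition \<nu>" and irr: "\<not> (\<exists>\<rho>. remove_domino \<nu> \<rho>)"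
  shows "part \<nu> r = length \<nu> - r"
proof -
  let ?p = "part \<nu>"
  have p0: "?p r = 0" if "length \<nu> \<le> r" for r
    using that by (simp add: part_def)
  note mono = part_antimono[OF \<nu>]
  have le1: "?p r \<le> Suc (?p (Suc r))" for r
  proof (rule ccontr)
    assume *: "\<not> ?p r \<le> Suc (?p (Suc r))"
    define f where "f = ?p(r := ?p r - 2)"
    obtain \<rho> where \<rho>: "is_partition \<rho>" "part \<rho> = f"
    proof (rule ex_partition[of f "max (Suc r) (length \<nu>)"])
      show "f s' \<le> f s" if "s \<le> s'" for s s'
        using * mono[OF that] mono[of "Suc r" s'] that
        by (cases "s' = s") (auto simp: f_def)
      show "f (max (Suc r) (length \<nu>)) = 0"
        using p0[of "max (Suc r) (length \<nu>)"] by (auto simp: f_def)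
    qed
    have "cells \<nu> - cells \<rho> = {(r, ?p r - 2), (r, Suc (?p r - 2))}"
      using * by (auto simp: cells_part \<rho> f_def split: if_splits)
    moreover have "cells \<rho> \<subseteq> cells \<nu>"
      by (auto simp: cells_part \<rho> f_def split: if_splits)
    ultimately have "remove_domino \<nu> \<rho>"
      using \<nu> \<rho> unfolding remove_domino_def is_domino_def by blast
    with irr show False by blast
  qed
  have ne: "?p (Suc r) < ?p r" if "r < length \<nu>" for r
  proof (rule ccontr)
    assume "\<not> ?p (Suc r) < ?p r"
    then have "r < length \<nu> \<and> ?p (Suc r) = ?p r"
      using mono[of r "Suc r"] that by simp
    then obtain s where s: "s < length \<nu>" "?p (Suc s) = ?p s"
      and max: "\<And>u. u < length \<nu> \<and> ?p (Suc u) = ?p u \<Longrightarrow> u \<le> s"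
      using ex_has_greatest_nat[of "\<lambda>r. r < length \<nu> \<and> ?p (Suc r) = ?p r" r "\<lambda>r. r" "length \<nu>"]
      by (auto simp: less_imp_le)
    then have pos: "0 < ?p s" using part_pos_iff[OF \<nu>] by blast
    \<comment> \<open>Row s + 1 is as long as row s, hence non-empty; maximality of s then forces a
      strict drop below it.\<close>
    then have "Suc s < length \<nu>" using part_pos_iff[OF \<nu>, of "Suc s"] s by simp
    then have lt: "?p (Suc (Suc s)) < ?p s"
      using max[of "Suc s"] mono[of "Suc s" "Suc (Suc s)"] s by fastforce
    define f where "f = ?p(s := ?p s - 1, Suc s := ?p s - 1)"
    obtain \<rho> where \<rho>: "is_partition \<rho>" "part \<rho> = f"
    proof (rule ex_partition[of f "length \<nu>"])
      show "f u' \<le> f u" if "u \<le> u'" for u u'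
        using lt mono[OF that] mono[of "Suc (Suc s)" u'] that s
        by (cases "u' = u"; cases "u = s"; cases "u = Suc s"; cases "u' = Suc s") (auto simp: f_def)
      show "f (length \<nu>) = 0"
        using p0[of "length \<nu>"] \<open>Suc s < length \<nu>\<close> by (auto simp: f_def)
    qed
    have "cells \<nu> - cells \<rho> = {(s, ?p s - 1), (Suc s, ?p s - 1)}"
      using pos s by (auto simp: cells_part \<rho> f_def split: if_splits)
    moreover have "cells \<rho> \<subseteq> cells \<nu>"
      using s by (auto simp: cells_part \<rho> f_def split: if_splits)
    ultimately have "remove_domino \<nu> \<rho>"
      using \<nu> \<rho> unfolding remove_domino_def is_domino_def by blast
    with irr show False by blast
  qed
  show ?thesis
  proof (cases "r \<le> length \<nu>")
    case True
    then show ?thesis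
    proof (induction r rule: inc_induct)
      case (step r)
      then show ?case using le1[of r] ne[of r] by linarith
    qed (simp add: p0)
  qed (simp add: p0)
qed

section \<open>Full columns and the weight of staircases\<close>

text \<open>Only meaningful for at most \<open>n\<close> rows, where it prepends a column of height \<open>n\<close>.\<close>

definition addcol :: "nat \<Rightarrow> nat list \<Rightarrow> nat list" where
  "addcol n \<mu> = map Suc (\<mu> @ replicate (n - length \<mu>) 0)"

lemma length_addcol: "length \<mu> \<le> n \<Longrightarrow> length (addcol n \<mu>) = n"
  by (simp add: addcol_def)

lemma part_addcol:
  "length \<mu> \<le> n \<Longrightarrow> part (addcol n \<mu>) r = (if r < n then Suc (part \<mu> r) else 0)"
  by (auto simp: addcol_def part_def nth_append)

lemma is_partition_addcol: "is_partition \<mu> \<Longrightarrow> is_partition (addcol n \<mu>)"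
proof -
  have "sorted_wrt (\<ge>) (replicate k (1 :: nat))" for k
    by (induction k) auto
  then show "is_partition \<mu> \<Longrightarrow> is_partition (addcol n \<mu>)"
    by (auto simp: addcol_def is_partition_def sorted_wrt_append sorted_wrt_map)
qed

lemma sum_list_addcol: "length \<mu> \<le> n \<Longrightarrow> sum_list (addcol n \<mu>) = n + sum_list \<mu>"
  by (simp add: sum_list_part[of _ n] length_addcol part_addcol sum.distrib[of _ "\<lambda>_. 1", simplified] sum_Suc)

text \<open>The shift to the right flips the sign of every old cell; the signs in the new column
  alternate and sum to 1 or 0.\<close>

lemma bg_addcol:
  assumes "length \<mu> \<le> n"
  shows "bg (addcol n \<mu>) = of_bool (odd n) - bg \<mu>"
proof -
  have "bg (addcol n \<mu>) = (\<Sum>r<n. \<Sum>c<Suc (part \<mu> r). (-1) ^ (r + c))"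
    using assms by (simp add: bg_part[of _ n] length_addcol part_addcol del: sum.lessThan_Suc)
  also have "\<dots> = (\<Sum>r<n. (-1) ^ r - (\<Sum>c<part \<mu> r. (-1) ^ (r + c)))"
    by (simp add: sum.lessThan_Suc_shift sum_negf del: sum.lessThan_Suc)
  also have "\<dots> = (\<Sum>r<n. (-1) ^ r) - bg \<mu>"
    using assms by (simp add: sum_subtractf bg_part[of _ n])
  also have "(\<Sum>r<n. (-1 :: int) ^ r) = of_bool (odd n)"
    by (induction n) auto
  finally show ?thesis .
qed

text \<open>The next staircase arises by prepending a column one taller, so \<open>bg_addcol\<close>
  produces the weights 0, 1, -1, 2, -2, and so on: every integer once.\<close>

lemma staircase_bg:
  assumes "is_partition \<nu>" "\<And>r. part \<nu> r = s - r"
  shows "bg \<nu> = (if even s then - int (s div 2) else int (Suc s div 2)) \<and> 2 * sum_list \<nu> = s * Suc s"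
  using assms
proof (induction s arbitrary: \<nu>)
  case 0
  then have "part \<nu> = part []" by (auto simp: part_def)
  then have "\<nu> = []" using 0 by (intro part_inj) (auto simp: is_partition_def)
  then show ?case by (simp add: bg_def cells_def)
next
  case (Suc s)
  obtain \<rho> where \<rho>: "is_partition \<rho>" "part \<rho> = (\<lambda>r. s - r)"
    by (rule ex_partition[of "\<lambda>r. s - r" s]) auto
  have len: "length \<rho> \<le> Suc s"
    using part_pos_iff[OF \<rho>(1), of "Suc s"] \<rho>(2) by simp
  have "\<nu> = addcol (Suc s) \<rho>"
    using Suc.prems \<rho> len
    by (intro part_inj is_partition_addcol) (auto simp: part_addcol fun_eq_iff)
  moreover have "bg \<rho> = (if even s then - int (s div 2) else int (Suc s div 2)) \<and> 2 * sum_list \<rho> = s * Suc s"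
    using \<rho> by (intro Suc.IH) auto
  ultimately show ?case
    using len by (auto simp: bg_addcol sum_list_addcol elim!: oddE)
qed

section \<open>Core size as a function of the checkerboard weight\<close>

lemma int_core_size: "int (core_size j) = j * (2 * j - 1)"
proof -
  have "j * (2 * j - 1) \<ge> 0"
    by (cases "j \<ge> 1") (auto simp: zero_le_mult_iff)
  then show ?thesis by (simp add: core_size_def)
qed

text \<open>The difference of the two sizes factors as (i - j) (2 (i + j) - 1), and the second
  factor is odd.\<close>

lemma core_size_inject: "core_size i = core_size j \<longleftrightarrow> i = j"
proof
  assume "core_size i = core_size j"
  then have "i * (2 * i - 1) = j * (2 * j - 1)"
    by (simp flip: int_core_size)
  then have "(i - j) * (2 * (i + j) - 1) = 0"
    by (simp add: algebra_simps)
  moreover have "2 * (i + j) - 1 \<noteq> 0" by presburger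
  ultimately show "i = j" by simp
qed simp

text \<open>The weight j is -m for s = 2m and m + 1 for s = 2m + 1; either way j (2j - 1) = s (s +
  1) / 2.\<close>

lemma staircase_core_size:
  assumes "is_partition \<nu>" "\<And>r. part \<nu> r = s - r"
  shows "sum_list \<nu> = core_size (bg \<nu>)"
proof -
  have "2 * int (sum_list \<nu>) = int (2 * sum_list \<nu>)"
    by simp
  also have "\<dots> = int (s * Suc s)"
    using staircase_bg[OF assms] by simp
  also have "\<dots> = 2 * (bg \<nu> * (2 * bg \<nu> - 1))"
  proof (cases "even s")
    case True
    then obtain m where "s = 2 * m" by (rule evenE)
    then show ?thesis
      using staircase_bg[OF assms] by (simp add: algebra_simps)
  next
    case False
    then obtain m where "s = 2 * m + 1" by (rule oddE)
    then show ?thesis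
      using staircase_bg[OF assms] by (simp add: algebra_simps)
  qed
  finally have "2 * int (sum_list \<nu>) = 2 * int (core_size (bg \<nu>))"
    by (simp only: int_core_size)
  then show ?thesis by simp
qed

lemma strict_mono_mult_Suc: "strict_mono (\<lambda>n :: nat. n * Suc n)"
  by (rule strict_monoI, rule mult_strict_mono) simp_all

text \<open>Decrease of size gives an irreducible partition reachable from \<mu>. Any such one is a
  staircase with the weight of \<mu>, so its size and hence its length are determined; this
  uniqueness justifies the \<open>THE\<close> in \<open>two_core\<close>.\<close>

lemma two_core_sum_list:
  assumes "is_partition \<mu>"
  shows "sum_list (two_core \<mu>) = core_size (bg \<mu>)"
proof -
  let ?Q = "\<lambda>\<nu>. remove_domino\<^sup>*\<^sup>* \<mu> \<nu> \<and> \<not> (\<exists>\<rho>. remove_domino \<nu> \<rho>)"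
  have "\<exists>\<nu>. ?Q \<nu>"
  proof (induction "sum_list \<mu>" arbitrary: \<mu> rule: less_induct)
    case less
    show ?case
    proof (cases "\<exists>\<rho>. remove_domino \<mu> \<rho>")
      case True
      then obtain \<rho> where "remove_domino \<mu> \<rho>" by blast
      with less[OF remove_domino_sum_list] show ?thesis
        by (meson converse_rtranclp_into_rtranclp)
    qed blast
  qed
  then obtain \<nu> where \<nu>: "?Q \<nu>" by blast
  have inv: "is_partition \<rho> \<and> bg \<rho> = bg \<mu>" if "remove_domino\<^sup>*\<^sup>* \<mu> \<rho>" for \<rho>
    using that
  proof induction
    case (step \<rho> \<sigma>)
    then show ?case using remove_domino_bg[of \<rho> \<sigma>] by (simp add: remove_domino_def)
  qed (simp add: assms)
  have stair: "is_partition \<rho>" "part \<rho> r = length \<rho> - r" "sum_list \<rho> = core_size (bg \<mu>)"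
    if "?Q \<rho>" for \<rho> r
  proof -
    show *: "is_partition \<rho>" "part \<rho> r = length \<rho> - r" for r
      using inv[of \<rho>] that irreducible_staircase by blast+
    show "sum_list \<rho> = core_size (bg \<mu>)"
      using staircase_core_size[OF *] inv[of \<rho>] that by simp
  qed
  have "\<rho> = \<nu>" if "?Q \<rho>" for \<rho>
  proof -
    have "length \<rho> * Suc (length \<rho>) = length \<nu> * Suc (length \<nu>)"
      using staircase_bg[OF stair(1,2)[OF that]] staircase_bg[OF stair(1,2)[OF \<nu>]]
        stair(3)[OF that] stair(3)[OF \<nu>] by simp
    then have "length \<rho> = length \<nu>"
      using strict_mono_eq[OF strict_mono_mult_Suc] by blast
    then have "part \<rho> = part \<nu>"
      using stair(2)[OF that] stair(2)[OF \<nu>] by (intro ext) (simp only:)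
    then show ?thesis
      using stair(1)[OF that] stair(1)[OF \<nu>] by (intro part_inj)
  qed
  then have "two_core \<mu> = \<nu>"
    unfolding two_core_def using \<nu> by (intro the_equality)
  then show ?thesis using stair(3)[OF \<nu>] by simp
qed

lemma core_class_bg: "core_class j = {\<mu>. is_partition \<mu> \<and> bg \<mu> = j}"
  by (auto simp: core_class_def two_core_sum_list core_size_inject)

section \<open>A recurrence for partitions with boundedly many rows\<close>

text \<open>\<open>fps_X\<close> marks the size and T marks \<open>h20\<close>. The index sets are
  finite when S consists of partitions; over an infinite one \<open>sum\<close> would be 0.\<close>

definition gf :: "'a::comm_ring_1 \<Rightarrow> nat list set \<Rightarrow> 'a fps" where
  "gf T S = Abs_fps (\<lambda>N. \<Sum>\<mu> | \<mu> \<in> S \<and> sum_list \<mu> = N. T ^ h20 \<mu>)"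

lemma finite_partitions_subset:
  "S \<subseteq> Collect is_partition \<Longrightarrow> finite {\<mu> \<in> S. sum_list \<mu> = N}"
  by (rule finite_subset[OF _ finite_partitions[of N]]) blast

lemma gf_Un:
  assumes "A \<subseteq> Collect is_partition" "B \<subseteq> Collect is_partition" "A \<inter> B = {}"
  shows "gf T (A \<union> B) = gf T A + gf T B"
proof (rule fps_ext)
  fix N
  have "{\<mu>. \<mu> \<in> A \<union> B \<and> sum_list \<mu> = N} = {\<mu> \<in> A. sum_list \<mu> = N} \<union> {\<mu> \<in> B. sum_list \<mu> = N}"
    by blast
  then show "gf T (A \<union> B) $ N = (gf T A + gf T B) $ N"
    using assms by (simp add: gf_def sum.union_disjoint finite_partitions_subset disjoint_iff)
qed

lemma gf_image:
  assumes "inj_on \<phi> A"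
    and "\<And>\<mu>. \<mu> \<in> A \<Longrightarrow> sum_list (\<phi> \<mu>) = s + sum_list \<mu>"
    and "\<And>\<mu>. \<mu> \<in> A \<Longrightarrow> h20 (\<phi> \<mu>) = h + h20 \<mu>"
  shows "gf T (\<phi> ` A) = fps_const (T ^ h) * fps_X ^ s * gf T A"
proof (rule fps_ext)
  fix N
  have "{\<mu>. \<mu> \<in> \<phi> ` A \<and> sum_list \<mu> = N} = \<phi> ` {\<mu> \<in> A. s + sum_list \<mu> = N}"
    using assms(2) by auto
  then have "gf T (\<phi> ` A) $ N = (\<Sum>\<mu> | \<mu> \<in> A \<and> s + sum_list \<mu> = N. T ^ h20 (\<phi> \<mu>))"
    using inj_on_subset[OF assms(1), of "{\<mu> \<in> A. s + sum_list \<mu> = N}"]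
    by (simp add: gf_def sum.reindex)
  also have "\<dots> = (\<Sum>\<mu> | \<mu> \<in> A \<and> s + sum_list \<mu> = N. T ^ h * T ^ h20 \<mu>)"
    using assms(3) by (intro sum.cong) (auto simp: power_add)
  also have "\<dots> = T ^ h * (if N < s then 0 else gf T A $ (N - s))"
  proof (cases "N < s")
    case False
    then have "s + m = N \<longleftrightarrow> m = N - s" for m by auto
    then show ?thesis using False by (simp add: gf_def sum_distrib_left)
  qed auto
  also have "\<dots> = (fps_const (T ^ h) * fps_X ^ s * gf T A) $ N"
    by (simp add: mult.assoc fps_X_power_mult_nth)
  finally show "gf T (\<phi> ` A) $ N = (fps_const (T ^ h) * fps_X ^ s * gf T A) $ N" .
qed

text \<open>The new column is the only one of length n + 1, so no pair arises.\<close>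

lemma h20_addcol:
  assumes "is_partition \<mu>" "length \<mu> \<le> n"
  shows "h20 (addcol (Suc n) \<mu>) = h20 \<mu>"
  using assms
  by (simp add: h20_part[of _ "Suc n"] is_partition_addcol length_addcol part_addcol)
     (simp add: part_def)

text \<open>Two further columns of the maximal length n + 1 form one new pair; the other
  multiplicities stay the same.\<close>

lemma h20_addcol2:
  assumes "is_partition \<mu>" "length \<mu> \<le> Suc n"
  shows "h20 (addcol (Suc n) (addcol (Suc n) \<mu>)) = Suc (h20 \<mu>)"
  using assms
  by (simp add: h20_part[of _ "Suc n"] is_partition_addcol length_addcol part_addcol)
     (simp add: part_def)

definition row_parts :: "nat \<Rightarrow> int \<Rightarrow> nat list set" where
  "row_parts n k = {\<mu>. is_partition \<mu> \<and> length \<mu> \<le> n \<and> bg \<mu> = k}"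

lemma inj_on_addcol: "inj_on (addcol n) {\<mu>. is_partition \<mu> \<and> length \<mu> \<le> n}"
proof (rule inj_onI; clarify)
  fix \<mu> \<nu>
  assume *: "is_partition \<mu>" "length \<mu> \<le> n" "is_partition \<nu>" "length \<nu> \<le> n" "addcol n \<mu> = addcol n \<nu>"
  have "part \<mu> r = part \<nu> r" for r
  proof (cases "r < n")
    case True
    moreover have "part (addcol n \<mu>) r = part (addcol n \<nu>) r"
      by (simp only: *(5))
    ultimately show ?thesis
      by (simp add: part_addcol *(2,4))
  qed (use * in \<open>simp add: part_def\<close>)
  then show "\<mu> = \<nu>" using * by (intro part_inj) auto
qed

lemma ex_addcol:
  assumes "is_partition \<nu>" "length \<nu> = n"
  obtains \<rho> where "is_partition \<rho>" "length \<rho> \<le> n" "\<nu> = addcol n \<rho>"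
proof -
  obtain \<rho> where \<rho>: "is_partition \<rho>" "part \<rho> = (\<lambda>r. part \<nu> r - 1)"
    using assms
    by (elim ex_partition[of "\<lambda>r. part \<nu> r - 1" n, rotated 2])
       (auto intro!: diff_le_mono part_antimono simp: part_def[of _ n])
  have len: "length \<rho> \<le> n"
    using part_pos_iff[OF \<rho>(1), of n] assms by (auto simp: \<rho> part_def)
  have "part \<nu> r = part (addcol n \<rho>) r" for r
    using part_pos_iff[OF assms(1), of r] assms(2) len by (auto simp: part_addcol \<rho>)
  then have "\<nu> = addcol n \<rho>"
    using assms \<rho> by (intro part_inj is_partition_addcol) auto
  with \<rho> len show ?thesis using that by blast
qed

text \<open>According to the multiplicity 0, 1 or at least 2 of columns of length \<open>n + 1\<close>;
  prepending two equal columns preserves the checkerboard weight.\<close>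

lemma row_parts_Suc:
  "row_parts (Suc n) k = row_parts n k \<union> addcol (Suc n) ` row_parts n (of_bool (even n) - k) \<union>
     (addcol (Suc n) \<circ> addcol (Suc n)) ` row_parts (Suc n) k" (is "_ = ?R")
proof (rule equalityI)
  show "row_parts (Suc n) k \<subseteq> ?R"
  proof
    fix \<nu> assume \<nu>: "\<nu> \<in> row_parts (Suc n) k"
    show "\<nu> \<in> ?R"
    proof (cases "length \<nu> = Suc n")
      case True
      then obtain \<rho> where \<rho>: "is_partition \<rho>" "length \<rho> \<le> Suc n" "\<nu> = addcol (Suc n) \<rho>"
        using \<nu> ex_addcol[of \<nu> "Suc n"] by (auto simp: row_parts_def)
      show ?thesis
      proof (cases "length \<rho> = Suc n")
        case True
        then obtain \<sigma> where "is_partition \<sigma>" "length \<sigma> \<le> Suc n" "\<rho> = addcol (Suc n) \<sigma>"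
          using \<rho> ex_addcol[of \<rho> "Suc n"] by blast
        then show ?thesis using \<nu> \<rho> by (auto simp: row_parts_def bg_addcol)
      next
        case False
        then show ?thesis using \<nu> \<rho> by (auto simp: row_parts_def bg_addcol)
      qed
    qed (use \<nu> in \<open>auto simp: row_parts_def\<close>)
  qed
  show "?R \<subseteq> row_parts (Suc n) k"
    by (auto simp: row_parts_def is_partition_addcol length_addcol bg_addcol)
qed

text \<open>The third class of \<open>row_parts_Suc\<close> is a copy of the whole set with size
  raised by 2 (n + 1) and one more pair; moving it to the left gives the factor there.\<close>

lemma gf_row_parts_Suc:
  "(1 - fps_const T * fps_X ^ (2 * Suc n)) * gf T (row_parts (Suc n) k) =
     gf T (row_parts n k) + fps_X ^ Suc n * gf T (row_parts n (of_bool (even n) - k))"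
proof -
  let ?A = "row_parts n k"
  let ?B = "addcol (Suc n) ` row_parts n (of_bool (even n) - k)"
  let ?C = "(addcol (Suc n) \<circ> addcol (Suc n)) ` row_parts (Suc n) k"
  have AB: "?A \<inter> ?B = {}"
    by (auto simp: row_parts_def length_addcol)
  \<comment> \<open>Row n, counted from 0, has length at least 2 in the third class and at most 1 in
    the other two.\<close>
  have "\<mu> \<noteq> addcol (Suc n) (addcol (Suc n) \<nu>)" if "\<mu> \<in> ?A \<union> ?B" "\<nu> \<in> row_parts (Suc n) k" for \<mu> \<nu>
  proof
    assume eq: "\<mu> = addcol (Suc n) (addcol (Suc n) \<nu>)"
    then have "part \<mu> n = part \<nu> n + 2"
      using that by (simp add: row_parts_def part_addcol length_addcol)
    moreover have "part \<mu> n \<le> 1"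
      using that(1) by (auto simp: row_parts_def part_addcol) (auto simp: part_def)
    ultimately show False by simp
  qed
  then have ABC: "(?A \<union> ?B) \<inter> ?C = {}" by fastforce
  have sub: "?A \<subseteq> Collect is_partition" "?B \<subseteq> Collect is_partition" "?C \<subseteq> Collect is_partition"
    by (auto simp: row_parts_def is_partition_addcol)
  have "gf T (row_parts (Suc n) k) = gf T (?A \<union> ?B \<union> ?C)"
    by (subst row_parts_Suc) (rule refl)
  also have "\<dots> = gf T ?A + gf T ?B + gf T ?C"
    using sub AB ABC by (simp add: gf_Un)
  also have "gf T ?B = fps_const (T ^ 0) * fps_X ^ Suc n * gf T (row_parts n (of_bool (even n) - k))"
    by (rule gf_image)
       (auto simp: row_parts_def sum_list_addcol h20_addcol intro: inj_on_subset[OF inj_on_addcol])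
  also have "gf T ?C = fps_const (T ^ 1) * fps_X ^ (2 * Suc n) * gf T (row_parts (Suc n) k)"
  proof (rule gf_image)
    show "inj_on (addcol (Suc n) \<circ> addcol (Suc n)) (row_parts (Suc n) k)"
      by (rule comp_inj_on; rule inj_on_subset[OF inj_on_addcol])
         (auto simp: row_parts_def is_partition_addcol length_addcol)
  qed (auto simp: row_parts_def sum_list_addcol h20_addcol2 length_addcol)
  finally show ?thesis by (simp add: algebra_simps)
qed

lemma row_parts_0: "row_parts 0 k = (if k = 0 then {[]} else {})"
  by (auto simp: row_parts_def is_partition_def bg_def cells_def)

lemma gf_row_parts_0: "gf T (row_parts 0 k) = of_bool (k = 0)"
proof (rule fps_ext)
  fix N
  have "{\<mu>. \<mu> \<in> row_parts 0 k \<and> sum_list \<mu> = N} = (if k = 0 \<and> N = 0 then {[]} else {})"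
    by (auto simp: row_parts_0)
  then show "gf T (row_parts 0 k) $ N = of_bool (k = 0) $ N"
    by (simp add: gf_def h20_def cells_def)
qed

section \<open>Solving the recurrence by q-binomial coefficients\<close>

text \<open>The q-Pochhammer symbol (c q^2; q^2)_n with q = \<open>fps_X\<close>.\<close>

definition qpoch :: "'a::comm_ring_1 fps \<Rightarrow> nat \<Rightarrow> 'a fps" where
  "qpoch c n = (\<Prod>i<n. 1 - c * fps_X ^ (2 * Suc i))"

lemma qpoch_Suc: "qpoch c (Suc n) = qpoch c n * (1 - c * fps_X ^ (2 * Suc n))"
  by (simp add: qpoch_def)

text \<open>By the recurrence below this counts the partitions whose columns have distinct lengths.\<close>

definition strict_gf :: "'a::comm_ring_1 \<Rightarrow> nat \<Rightarrow> int \<Rightarrow> 'a fps" where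
  "strict_gf T n k = gf T (row_parts n k) * qpoch (fps_const T) n"

lemma strict_gf_0: "strict_gf T 0 k = of_bool (k = 0)"
  by (simp add: strict_gf_def gf_row_parts_0 qpoch_def)

text \<open>\<open>qpoch\<close> absorbs the factor on the left of \<open>gf_row_parts_Suc\<close>,
  which leaves a recurrence free of T.\<close>

lemma strict_gf_Suc:
  "strict_gf T (Suc n) k = strict_gf T n k + fps_X ^ Suc n * strict_gf T n (of_bool (even n) - k)"
proof -
  have "strict_gf T (Suc n) k =
    ((1 - fps_const T * fps_X ^ (2 * Suc n)) * gf T (row_parts (Suc n) k)) * qpoch (fps_const T) n"
    by (simp add: strict_gf_def qpoch_Suc mult_ac)
  then show ?thesis
    unfolding gf_row_parts_Suc by (simp add: strict_gf_def algebra_simps)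
qed

text \<open>These are the zero values of the q-binomial of n over n div 2 + k outside 0 to n; they
  settle the boundary cases of the q-Pascal rule.\<close>

lemma strict_gf_eq_0:
  "int (n div 2) + k < 0 \<or> int (n div 2) + k > int n \<Longrightarrow> strict_gf T n k = 0"
proof (induction n arbitrary: k)
  case 0
  then show ?case by (auto simp: strict_gf_0)
next
  case (Suc n)
  define h where "h = n div 2"
  have "even n \<and> n = 2 * h \<and> Suc n div 2 = h \<or> odd n \<and> n = Suc (2 * h) \<and> Suc n div 2 = Suc h"
    unfolding h_def by presburger
  \<comment> \<open>With a = Suc n div 2 + k outside 0 to n + 1, the two indices are a and n + 1 - a
    for even n, and a - 1 and n - a for odd n.\<close>
  then have "int h + k < 0 \<or> int h + k > int n"
    and "int h + (of_bool (even n) - k) < 0 \<or> int h + (of_bool (even n) - k) > int n"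
    using Suc.prems by auto
  then show ?case
    using Suc.IH[of k] Suc.IH[of "of_bool (even n) - k"] by (simp add: strict_gf_Suc h_def)
qed

text \<open>The q^2-binomial of n over a, times a power of q, with denominators cleared so that the
  identity lives over any commutative ring. The induction is the q-Pascal rule; \<open>left\<close>
  and \<open>right\<close> treat the neighbours a - 1 and a in the row above.\<close>

lemma strict_gf_qpoch:
  assumes "a + b = n"
  shows "strict_gf T n (int a - int (n div 2)) * (qpoch 1 a * qpoch 1 b) =
         fps_X ^ core_size (int a - int (n div 2)) * qpoch 1 n"
  using assms
proof (induction n arbitrary: a b)
  case 0
  then show ?case by (simp add: strict_gf_0 qpoch_def core_size_def)
next
  case (Suc n)
  let ?h = "int (n div 2)"
  have left: "strict_gf T n (int a - 1 - ?h) * (qpoch 1 a * qpoch 1 b) =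
      fps_X ^ core_size (int a - 1 - ?h) * qpoch 1 n * (1 - fps_X ^ (2 * a))" if "a + b = Suc n" for a b
  proof (cases a)
    \<comment> \<open>Both sides vanish: the index is out of range, and 1 - \<open>fps_X ^ 0\<close>
      is 0.\<close>
    case 0
    then show ?thesis by (simp add: strict_gf_eq_0)
  next
    case (Suc a')
    then have k: "int a - 1 - ?h = int a' - ?h" and "a' + b = n" using that by simp_all
    have "strict_gf T n (int a' - ?h) * (qpoch 1 a * qpoch 1 b) =
        strict_gf T n (int a' - ?h) * (qpoch 1 a' * qpoch 1 b) * (1 - fps_X ^ (2 * a))"
      unfolding Suc qpoch_Suc by (simp only: mult_1 mult_ac)
    then show ?thesis
      unfolding k Suc.IH[OF \<open>a' + b = n\<close>] .
  qed
  have right: "strict_gf T n (int a - ?h) * (qpoch 1 a * qpoch 1 b) =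
      fps_X ^ core_size (int a - ?h) * qpoch 1 n * (1 - fps_X ^ (2 * b))" if "a + b = Suc n" for a b
  proof (cases b)
    case 0
    then show ?thesis using that by (simp add: strict_gf_eq_0)
  next
    case (Suc b')
    then have "a + b' = n" using that by simp
    have "strict_gf T n (int a - ?h) * (qpoch 1 a * qpoch 1 b) =
        strict_gf T n (int a - ?h) * (qpoch 1 a * qpoch 1 b') * (1 - fps_X ^ (2 * b))"
      unfolding Suc qpoch_Suc by (simp only: mult_1 mult_ac)
    then show ?thesis
      unfolding Suc.IH[OF \<open>a + b' = n\<close>] .
  qed
  have ba: "b + a = Suc n" using Suc.prems by simp
  let ?k = "int a - int (Suc n div 2)" and ?l = "of_bool (even n) - (int a - int (Suc n div 2))"
  let ?P = "qpoch 1 a * qpoch 1 b :: 'a fps"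
  \<comment> \<open>The parity of n decides which neighbour occurs: \<open>right\<close> with x = b
    and y = a for even n, \<open>left\<close> with x = a and y = b for odd n. The last conjunct
    aligns the powers of q.\<close>
  have "\<exists>x y. x + y = Suc n \<and>
     strict_gf T n ?k * ?P = fps_X ^ core_size ?k * qpoch 1 n * (1 - fps_X ^ (2 * x)) \<and>
     strict_gf T n ?l * ?P = fps_X ^ core_size ?l * qpoch 1 n * (1 - fps_X ^ (2 * y)) \<and>
     Suc n + core_size ?l = core_size ?k + 2 * x"
  proof (cases "even n")
    case True
    then obtain m where m: "n = 2 * m" by (rule evenE)
    have b: "int b = 2 * int m + 1 - int a" using m Suc.prems by simp
    have k: "?k = int a - ?h" and l: "?l = int b - ?h" using m b by simp_all
    have "int (Suc n + core_size ?l) = int (core_size ?k + 2 * b)"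
      unfolding k l of_nat_add int_core_size of_nat_mult b by (simp add: m algebra_simps)
    then have "Suc n + core_size ?l = core_size ?k + 2 * b"
      by (simp only: of_nat_eq_iff)
    with right[OF Suc.prems] right[OF ba] ba show ?thesis
      unfolding mult.commute[of "qpoch 1 b"] l unfolding k by blast
  next
    case False
    then obtain m where m: "n = 2 * m + 1" by (rule oddE)
    have b: "int b = 2 * int m + 2 - int a" using m Suc.prems by simp
    have k: "?k = int a - 1 - ?h" and l: "?l = int b - 1 - ?h" using m b by simp_all
    have "int (Suc n + core_size ?l) = int (core_size ?k + 2 * a)"
      unfolding k l of_nat_add int_core_size of_nat_mult b by (simp add: m algebra_simps)
    then have "Suc n + core_size ?l = core_size ?k + 2 * a"
      by (simp only: of_nat_eq_iff)
    with left[OF Suc.prems] left[OF ba] Suc.prems show ?thesis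
      unfolding mult.commute[of "qpoch 1 b"] l unfolding k by blast
  qed
  then obtain x y where xy: "x + y = Suc n"
    and t1: "strict_gf T n ?k * ?P = fps_X ^ core_size ?k * qpoch 1 n * (1 - fps_X ^ (2 * x))"
    and t2: "strict_gf T n ?l * ?P = fps_X ^ core_size ?l * qpoch 1 n * (1 - fps_X ^ (2 * y))"
    and e: "Suc n + core_size ?l = core_size ?k + 2 * x" by blast
  have "strict_gf T (Suc n) ?k * ?P = strict_gf T n ?k * ?P + fps_X ^ Suc n * (strict_gf T n ?l * ?P)"
    by (simp only: strict_gf_Suc ring_distribs mult.assoc)
  also have "\<dots> = fps_X ^ core_size ?k * qpoch 1 n * (1 - fps_X ^ (2 * x)) +
      fps_X ^ (Suc n + core_size ?l) * qpoch 1 n * (1 - fps_X ^ (2 * y))"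
    unfolding t1 t2 by (simp only: power_add mult.assoc)
  \<comment> \<open>With Q = q^2 this is (1 - Q^x) + Q^x (1 - Q^y) = 1 - Q^(x + y).\<close>
  also have "\<dots> = fps_X ^ core_size ?k * qpoch 1 n * (1 - fps_X ^ (2 * (x + y)))"
    unfolding e distrib_left power_add by (simp add: algebra_simps)
  also have "\<dots> = fps_X ^ core_size ?k * qpoch 1 (Suc n)"
    unfolding xy qpoch_Suc by (simp only: mult_1 mult.assoc)
  finally show ?case .
qed

section \<open>Passage to the limit\<close>

text \<open>Convergence means that each coefficient is eventually constant, and coefficient n of a
  product involves only coefficients up to n.\<close>

lemma tendsto_mult_fps:
  fixes f g :: "'b \<Rightarrow> 'a::ring_1 fps"
  assumes "(f \<longlongrightarrow> a) F" "(g \<longlongrightarrow> b) F"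
  shows "((\<lambda>x. f x * g x) \<longlongrightarrow> a * b) F"
proof (rule tendsto_fpsI)
  fix n
  have "\<forall>\<^sub>F x in F. \<forall>i\<in>{..n}. f x $ i = a $ i \<and> g x $ i = b $ i"
    using assms by (intro eventually_ball_finite) (auto simp: tendsto_fps_iff eventually_conj_iff)
  then show "\<forall>\<^sub>F x in F. (f x * g x) $ n = (a * b) $ n"
    by eventually_elim (simp add: fps_mult_nth)
qed

lemma qpoch_tendsto:
  obtains L where "qpoch c \<longlonglongrightarrow> L" "L \<noteq> 0"
proof -
  \<comment> \<open>Every factor after the first n + 1 differs from 1 only in degrees above
    n.\<close>
  have nth: "qpoch c (Suc n + d) $ n = qpoch c (Suc n) $ n" for n d
  proof (induction d)
    case (Suc d)
    have "qpoch c (Suc n + Suc d) = qpoch c (Suc n + d) -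
        fps_X ^ (2 * Suc (Suc n + d)) * (c * qpoch c (Suc n + d))"
      by (simp add: qpoch_Suc algebra_simps)
    then show ?case
      using Suc.IH by (simp add: fps_X_power_mult_nth del: power_Suc)
  qed simp
  have "qpoch c \<longlonglongrightarrow> Abs_fps (\<lambda>n. qpoch c (Suc n) $ n)"
  proof (rule tendsto_fpsI)
    fix n
    show "\<forall>\<^sub>F m in sequentially. qpoch c m $ n = Abs_fps (\<lambda>n. qpoch c (Suc n) $ n) $ n"
      using eventually_ge_at_top[of "Suc n"]
      by eventually_elim (metis fps_nth_Abs_fps le_iff_add nth)
  qed
  \<comment> \<open>The constant term makes the limit non-zero, as cancellation and
    \<open>raw_has_prod\<close> demand later.\<close>
  moreover have "Abs_fps (\<lambda>n. qpoch c (Suc n) $ n) $ 0 = 1"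
    by (simp add: qpoch_def)
  then have "Abs_fps (\<lambda>n. qpoch c (Suc n) $ n) \<noteq> 0"
    by (metis fps_zero_nth zero_neq_one)
  ultimately show ?thesis by (rule that)
qed

text \<open>A partition of N has at most N rows, so coefficient N is constant from n = N on.\<close>

lemma gf_row_parts_tendsto:
  "(\<lambda>n. gf T (row_parts n k)) \<longlonglongrightarrow> gf T {\<mu>. is_partition \<mu> \<and> bg \<mu> = k}"
proof (rule tendsto_fpsI)
  fix N
  show "\<forall>\<^sub>F n in sequentially. gf T (row_parts n k) $ N = gf T {\<mu>. is_partition \<mu> \<and> bg \<mu> = k} $ N"
    using eventually_ge_at_top[of N]
  proof eventually_elim
    case (elim n)
    then have "{\<mu>. \<mu> \<in> row_parts n k \<and> sum_list \<mu> = N} =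
      {\<mu>. \<mu> \<in> {\<mu>. is_partition \<mu> \<and> bg \<mu> = k} \<and> sum_list \<mu> = N}"
      by (auto simp: row_parts_def dest: length_le_sum_list)
    then show ?case by (simp add: gf_def)
  qed
qed

text \<open>Put n = 2m, a = m + k and b = m - k in \<open>strict_gf_qpoch\<close> and let m grow:
  all three factors \<open>qpoch 1\<close> tend to P1, and one P1 cancels on each side.\<close>

lemma gf_bg:
  fixes T :: "'a::idom"
  assumes T: "qpoch (fps_const T) \<longlonglongrightarrow> PT" and 1: "qpoch 1 \<longlonglongrightarrow> P1" and "P1 \<noteq> 0"
  shows "gf T {\<mu>. is_partition \<mu> \<and> bg \<mu> = k} * (P1 * PT) = fps_X ^ core_size k"
proof -
  let ?G = "gf T {\<mu>. is_partition \<mu> \<and> bg \<mu> = k}"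
  have at_top: "filterlim (\<lambda>m. nat (int m + i)) sequentially sequentially" for i
    unfolding filterlim_at_top
  proof
    fix Z
    show "\<forall>\<^sub>F m in sequentially. Z \<le> nat (int m + i)"
      using eventually_ge_at_top[of "nat (int Z + \<bar>i\<bar>)"] by eventually_elim linarith
  qed
  have double: "filterlim (\<lambda>m::nat. 2 * m) sequentially sequentially"
    by (rule mult_nat_left_at_top) simp
  have "(\<lambda>m. gf T (row_parts (2 * m) k) * qpoch (fps_const T) (2 * m) *
        (qpoch 1 (nat (int m + k)) * qpoch 1 (nat (int m + - k)))) \<longlonglongrightarrow> ?G * PT * (P1 * P1)"
    by (rule tendsto_mult_fps[OF
          tendsto_mult_fps[OF filterlim_compose[OF gf_row_parts_tendsto double] filterlim_compose[OF T double]]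
          tendsto_mult_fps[OF filterlim_compose[OF 1 at_top] filterlim_compose[OF 1 at_top]]])
  moreover have "\<forall>\<^sub>F m in sequentially. gf T (row_parts (2 * m) k) * qpoch (fps_const T) (2 * m) *
        (qpoch 1 (nat (int m + k)) * qpoch 1 (nat (int m + - k))) = fps_X ^ core_size k * qpoch 1 (2 * m)"
    \<comment> \<open>For m \<ge> |k| neither \<open>nat\<close> truncates, so the two indices add
      up to 2m.\<close>
    using eventually_ge_at_top[of "nat \<bar>k\<bar>"]
  proof eventually_elim
    case (elim m)
    then have "nat (int m + k) + nat (int m + - k) = 2 * m" "int (nat (int m + k)) - int (2 * m div 2) = k"
      by auto
    then show ?case
      using strict_gf_qpoch[of "nat (int m + k)" "nat (int m + - k)" "2 * m" T]
      by (simp add: strict_gf_def)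
  qed
  moreover have "(\<lambda>m. fps_X ^ core_size k * qpoch 1 (2 * m) :: 'a fps) \<longlonglongrightarrow> fps_X ^ core_size k * P1"
    by (rule tendsto_mult_fps[OF tendsto_const filterlim_compose[OF 1 double]])
  ultimately have "?G * PT * (P1 * P1) = fps_X ^ core_size k * P1"
    by (rule LIMSEQ_unique[OF Lim_transform_eventually])
  then show ?thesis
    using \<open>P1 \<noteq> 0\<close> by (simp add: mult_ac)
qed

text \<open>Coefficient N of a partial sum is final once its finite index set contains the finitely
  many partitions of N in S.\<close>

lemma has_sum_gf:
  assumes "S \<subseteq> Collect is_partition"
  shows "((\<lambda>\<mu>. fps_const T ^ h20 \<mu> * fps_X ^ sum_list \<mu>) has_sum gf T S) S"
  unfolding has_sum_def
proof (rule tendsto_fpsI)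
  fix N
  let ?f = "\<lambda>\<mu>. fps_const T ^ h20 \<mu> * fps_X ^ sum_list \<mu>"
  have "sum ?f F $ N = gf T S $ N" if F: "finite F" "{\<mu> \<in> S. sum_list \<mu> = N} \<subseteq> F" "F \<subseteq> S" for F
  proof -
    have "sum ?f F $ N = (\<Sum>\<mu>\<in>F. if sum_list \<mu> = N then T ^ h20 \<mu> else 0)"
      by (auto simp: fps_sum_nth fps_const_power fps_X_power_nth intro!: sum.cong)
    also have "\<dots> = (\<Sum>\<mu> | \<mu> \<in> F \<and> sum_list \<mu> = N. T ^ h20 \<mu>)"
      using F(1) by (simp add: sum.If_cases Int_def)
    also have "{\<mu>. \<mu> \<in> F \<and> sum_list \<mu> = N} = {\<mu>. \<mu> \<in> S \<and> sum_list \<mu> = N}"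
      using F by blast
    finally show ?thesis by (simp add: gf_def)
  qed
  then show "\<forall>\<^sub>F F in finite_subsets_at_top S. sum ?f F $ N = gf T S $ N"
    unfolding eventually_finite_subsets_at_top
    using finite_partitions_subset[OF assms, of N]
    by (intro exI[of _ "{\<mu> \<in> S. sum_list \<mu> = N}"]) auto
qed

theorem theorem5p15:
  fixes j :: int
  shows "((\<lambda>\<mu>. tX ^ h20 \<mu> * qX ^ sum_list \<mu>) has_sum
           (qX ^ core_size j /
              (\<Prod>i. (1 - qX ^ (2 * Suc i)) * (1 - tX * qX ^ (2 * Suc i))))) (core_class j)"
proof -
  let ?T = "Fract [:0, 1:] 1 :: int poly fract"
  let ?f = "\<lambda>i. (1 - qX ^ (2 * Suc i)) * (1 - tX * qX ^ (2 * Suc i))"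
  obtain P1 :: "int poly fract fps" where P1: "qpoch 1 \<longlonglongrightarrow> P1" "P1 \<noteq> 0"
    by (rule qpoch_tendsto)
  obtain PT where PT: "qpoch (fps_const ?T) \<longlonglongrightarrow> PT" "PT \<noteq> 0"
    by (rule qpoch_tendsto)
  \<comment> \<open>\<open>raw_has_prod\<close> multiplies over i \<le> n, that is n + 1 factors,
    hence \<open>Suc n\<close>.\<close>
  have "(\<lambda>n. qpoch 1 (Suc n) * qpoch (fps_const ?T) (Suc n)) \<longlonglongrightarrow> P1 * PT"
    by (intro tendsto_mult_fps LIMSEQ_Suc P1 PT)
  also have "(\<lambda>n. qpoch 1 (Suc n) * qpoch (fps_const ?T) (Suc n)) = (\<lambda>n. \<Prod>i\<le>n. ?f (i + 0))"
    by (simp only: qpoch_def lessThan_Suc_atMost qX_def tX_def prod.distrib mult_1 add_0_right)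
  finally have "raw_has_prod ?f 0 (P1 * PT)"
    unfolding raw_has_prod_def using P1(2) PT(2) by (intro conjI) simp_all
  then have "?f has_prod (P1 * PT)"
    unfolding has_prod_def by (rule disjI1)
  then have "(\<Prod>i. ?f i) = P1 * PT"
    by (rule has_prod_unique[symmetric])
  \<comment> \<open>The quotient is exact: the numerator is a multiple of the non-zero denominator
    by \<open>gf_bg\<close>.\<close>
  moreover have "qX ^ core_size j / (P1 * PT) = gf ?T (core_class j)"
  proof -
    have "qX ^ core_size j = gf ?T (core_class j) * (P1 * PT)"
      unfolding core_class_bg qX_def by (rule gf_bg[OF PT(1) P1, symmetric])
    then show ?thesis
      using P1(2) PT(2) by (simp only: nonzero_mult_div_cancel_right mult_eq_0_iff simp_thms)
  qed
  moreover have "core_class j \<subseteq> Collect is_partition"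
    by (simp add: core_class_bg Collect_mono)
  then have "((\<lambda>\<mu>. tX ^ h20 \<mu> * qX ^ sum_list \<mu>) has_sum gf ?T (core_class j)) (core_class j)"
    unfolding tX_def qX_def by (rule has_sum_gf)
  ultimately show ?thesis by (simp only:)
qed

end
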